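(* Let $L$ be a completely distributive lattice, $G$ a group, and $\mu$ an $L$-subgroup of $G$. Let $\eta$ be an abnormal $L$-subgroup of $\mu$. Then $\eta$ is a contranormal $L$-subgroup of $\mu$.
   Context: $L$ is a completely distributive (in particular complete) lattice with greatest element $1$ and least element $0$; $G$ is a group. An $L$-subset of $G$ is a function $G\to L$; $\eta\subseteq\nu$ means $\eta(x)\le\nu(x)$ for all $x\in G$; $(\eta\cup\nu)(x)=\eta(x)\vee\nu(x)$. An $L$-subgroup of $G$ is an $L$-subset $\mu$ with $\mu(xy)\ge\mu(x)\wedge\mu(y)$ and $\mu(x^{-1})=\mu(x)$ for all $x,y\in G$. An $L$-subgroup of $\mu$ is an $L$-subgroup $\eta$ of $G$ with $\eta\subseteq\mu$. For $a\in L$, $x\in G$, the $L$-point $a_x$ is the $L$-subset with value $a$ at $x$ and $0$ elsewhere; $a_x\in\mu$ means $\mu(x)\ge a$. For $\eta$ an $L$-subgroup of $\mu$ and $a_z\in\mu$, the conjugate $\eta^{a_z}$ is the $L$-subset $\eta^{a_z}(x)=a\wedge\eta(zxz^{-1})$, $x\in G$ (it is an $L$-subgroup of $\mu$). For $L$-subsets $\eta,\nu\subseteq\mu$, $\langle\eta,\nu\rangle$ is the $L$-subgroup of $\mu$ generated by $\eta\cup\nu$, i.e. the pointwise infimum of all $L$-subgroups $\theta$ of $\mu$ with $\eta\cup\nu\subseteq\theta$. An $L$-subgroup $\eta$ of $\mu$ is an abnormal $L$-subgroup of $\mu$ if for every $L$-point $a_x\in\mu$ one has $a_x\in\langle\eta,\eta^{a_x}\rangle$.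 An $L$-subgroup $\eta$ of $\mu$ is a contranormal $L$-subgroup of $\mu$ if there is no $L$-subgroup $\theta$ of $\mu$ with $\theta\neq\mu$ such that $\eta^{a_z}\subseteq\theta$ for every $L$-point $a_z\in\mu$. *)

theory Defs
  imports "HOL-Algebra.Group"
begin

text \<open>
  The lattice \<open>L\<close> is a type of class \<^class>\<open>complete_distrib_lattice\<close>, whose axiom is
  complete distributivity (arbitrary meets of arbitrary joins), and the group is given by its
  carrier. An \<open>L\<close>-subset of \<open>G\<close> is a function on the carrier; it is encoded as an extensional
  function, so that HOL equality of \<open>L\<close>-subsets is equality of functions on the carrier.
\<close>

definition L_subset :: "('a, 'm) monoid_scheme \<Rightarrow> ('a \<Rightarrow> 'l) \<Rightarrow> bool" where
  "L_subset G \<eta> \<longleftrightarrow> \<eta> \<in> extensional (carrier G)"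

definition L_contained ::
    "('a, 'm) monoid_scheme \<Rightarrow> ('a \<Rightarrow> 'l::complete_distrib_lattice) \<Rightarrow> ('a \<Rightarrow> 'l) \<Rightarrow> bool" where
  "L_contained G \<eta> \<nu> \<longleftrightarrow> (\<forall>x\<in>carrier G. \<eta> x \<le> \<nu> x)"

definition L_union ::
    "('a, 'm) monoid_scheme \<Rightarrow> ('a \<Rightarrow> 'l::complete_distrib_lattice) \<Rightarrow> ('a \<Rightarrow> 'l) \<Rightarrow> 'a \<Rightarrow> 'l" where
  "L_union G \<eta> \<nu> = (\<lambda>x\<in>carrier G. sup (\<eta> x) (\<nu> x))"

definition L_subgroup ::
    "('a, 'm) monoid_scheme \<Rightarrow> ('a \<Rightarrow> 'l::complete_distrib_lattice) \<Rightarrow> bool" where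
  "L_subgroup G \<mu> \<longleftrightarrow> L_subset G \<mu> \<and>
     (\<forall>x\<in>carrier G. \<forall>y\<in>carrier G. \<mu> (x \<otimes>\<^bsub>G\<^esub> y) \<ge> inf (\<mu> x) (\<mu> y)) \<and>
     (\<forall>x\<in>carrier G. \<mu> (inv\<^bsub>G\<^esub> x) = \<mu> x)"

definition L_subgroup_of ::
    "('a, 'm) monoid_scheme \<Rightarrow> ('a \<Rightarrow> 'l::complete_distrib_lattice) \<Rightarrow> ('a \<Rightarrow> 'l) \<Rightarrow> bool" where
  "L_subgroup_of G \<mu> \<eta> \<longleftrightarrow> L_subgroup G \<eta> \<and> L_contained G \<eta> \<mu>"

text \<open>
  The \<open>L\<close>-point \<open>a\<^sub>x\<close> is represented by its data \<open>a\<close> and \<open>x\<close>. As functions, all the points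
  \<open>0\<^sub>x\<close> coincide, whereas membership and conjugation are defined in terms of \<open>a\<close> and \<open>x\<close>.
\<close>

definition L_point_in ::
    "('a, 'm) monoid_scheme \<Rightarrow> 'l::complete_distrib_lattice \<Rightarrow> 'a \<Rightarrow> ('a \<Rightarrow> 'l) \<Rightarrow> bool" where
  "L_point_in G a x \<mu> \<longleftrightarrow> x \<in> carrier G \<and> \<mu> x \<ge> a"

definition L_conjugate ::
    "('a, 'm) monoid_scheme \<Rightarrow> ('a \<Rightarrow> 'l::complete_distrib_lattice) \<Rightarrow> 'l \<Rightarrow> 'a \<Rightarrow> 'a \<Rightarrow> 'l" where
  "L_conjugate G \<eta> a z = (\<lambda>x\<in>carrier G. inf a (\<eta> (z \<otimes>\<^bsub>G\<^esub> x \<otimes>\<^bsub>G\<^esub> inv\<^bsub>G\<^esub> z)))"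

definition L_generated ::
    "('a, 'm) monoid_scheme \<Rightarrow> ('a \<Rightarrow> 'l::complete_distrib_lattice) \<Rightarrow> ('a \<Rightarrow> 'l) \<Rightarrow> ('a \<Rightarrow> 'l) \<Rightarrow> 'a \<Rightarrow> 'l"
  where
  "L_generated G \<mu> \<eta> \<nu> =
     (\<lambda>x\<in>carrier G. INF \<theta>\<in>{\<theta>. L_subgroup_of G \<mu> \<theta> \<and> L_contained G (L_union G \<eta> \<nu>) \<theta>}. \<theta> x)"

definition abnormal_L_subgroup ::
    "('a, 'm) monoid_scheme \<Rightarrow> ('a \<Rightarrow> 'l::complete_distrib_lattice) \<Rightarrow> ('a \<Rightarrow> 'l) \<Rightarrow> bool" where
  "abnormal_L_subgroup G \<mu> \<eta> \<longleftrightarrow> L_subgroup_of G \<mu> \<eta> \<and>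
     (\<forall>a x. L_point_in G a x \<mu> \<longrightarrow>
        L_point_in G a x (L_generated G \<mu> \<eta> (L_conjugate G \<eta> a x)))"

definition contranormal_L_subgroup ::
    "('a, 'm) monoid_scheme \<Rightarrow> ('a \<Rightarrow> 'l::complete_distrib_lattice) \<Rightarrow> ('a \<Rightarrow> 'l) \<Rightarrow> bool" where
  "contranormal_L_subgroup G \<mu> \<eta> \<longleftrightarrow> L_subgroup_of G \<mu> \<eta> \<and>
     \<not> (\<exists>\<theta>. L_subgroup_of G \<mu> \<theta> \<and> \<theta> \<noteq> \<mu> \<and>
           (\<forall>a z. L_point_in G a z \<mu> \<longrightarrow> L_contained G (L_conjugate G \<eta> a z) \<theta>))"

end

theory Submission
  imports Defs
begin

text \<open>
  An \<open>L\<close>-subgroup \<open>\<theta>\<close> of \<open>\<mu>\<close> containing all conjugates of \<open>\<eta>\<close> contains \<open>\<eta>\<close> itself, which is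
  the conjugate by the point \<open>a\<^sub>e\<close> with \<open>e\<close> the identity and \<open>a = \<mu> e\<close>. Hence \<open>\<theta>\<close> contains
  every \<open>\<langle>\<eta>, \<eta>\<^bsup>a\<^sub>x\<^esup>\<rangle>\<close>, and abnormality at the points \<open>a\<^sub>x\<close> with \<open>a = \<mu> x\<close> gives \<open>\<mu> \<subseteq> \<theta>\<close>.
\<close>

text \<open>Containment compares values on the carrier only; off the carrier both functions agree
  because they are extensional.\<close>

lemma L_contained_antisym:
  assumes "L_subset G \<eta>" "L_subset G \<nu>" "L_contained G \<eta> \<nu>" "L_contained G \<nu> \<eta>"
  shows "\<eta> = \<nu>"
  using assms unfolding L_subset_def L_contained_def
  by (meson antisym extensionalityI)

lemma (in group) L_subgroup_le_one:
  assumes "L_subgroup G \<eta>" "x \<in> carrier G"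
  shows "\<eta> x \<le> \<eta> \<one>"
proof -
  have "inf (\<eta> x) (\<eta> (inv x)) \<le> \<eta> (x \<otimes> inv x)"
    using assms inv_closed[of x] unfolding L_subgroup_def by blast
  moreover have "\<eta> (inv x) = \<eta> x"
    using assms by (simp add: L_subgroup_def)
  ultimately show ?thesis using assms(2) by simp
qed

text \<open>Conjugation by \<open>\<one>\<close> moves no argument, and the meet with
  \<open>\<mu> \<one>\<close> cuts nothing off, since \<open>\<mu> \<one>\<close> bounds
  \<open>\<eta> \<one>\<close>, the largest value of \<open>\<eta>\<close>.\<close>

lemma (in group) L_conjugate_one:
  assumes "L_subgroup_of G \<mu> \<eta>"
  shows "L_conjugate G \<eta> (\<mu> \<one>) \<one> = \<eta>"
proof (rule extensionalityI)
  show "\<eta> \<in> extensional (carrier G)"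
    using assms by (simp add: L_subgroup_of_def L_subgroup_def L_subset_def)
  show "L_conjugate G \<eta> (\<mu> \<one>) \<one> \<in> extensional (carrier G)"
    by (simp add: L_conjugate_def)
  fix x assume x: "x \<in> carrier G"
  have "\<eta> x \<le> \<eta> \<one>"
    using assms x by (simp add: L_subgroup_of_def L_subgroup_le_one)
  also have "\<eta> \<one> \<le> \<mu> \<one>"
    using assms by (simp add: L_subgroup_of_def L_contained_def)
  finally show "L_conjugate G \<eta> (\<mu> \<one>) \<one> x = \<eta> x"
    using x by (simp add: L_conjugate_def inf_absorb2)
qed

text \<open>\<open>\<theta>\<close> is itself one of the L-subgroups over which the infimum is
  taken.\<close>

lemma L_generated_least:
  assumes "L_subgroup_of G \<mu> \<theta>" "L_contained G \<eta> \<theta>" "L_contained G \<nu> \<theta>"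
  shows "L_contained G (L_generated G \<mu> \<eta> \<nu>) \<theta>"
proof -
  have "L_contained G (L_union G \<eta> \<nu>) \<theta>"
    using assms(2,3) by (simp add: L_contained_def L_union_def)
  then show ?thesis
    using assms(1) by (auto simp: L_contained_def L_generated_def intro!: INF_lower)
qed

theorem theorem4p10:
  fixes G :: "('a, 'm) monoid_scheme"
    and \<mu> \<eta> :: "'a \<Rightarrow> 'l::complete_distrib_lattice"
  assumes "group G"
    and "L_subgroup G \<mu>"
    and "abnormal_L_subgroup G \<mu> \<eta>"
  shows "contranormal_L_subgroup G \<mu> \<eta>"
proof -
  interpret group G by fact
  have \<eta>: "L_subgroup_of G \<mu> \<eta>"
    using assms(3) by (simp add: abnormal_L_subgroup_def)
  have "\<theta> = \<mu>"
    if \<theta>: "L_subgroup_of G \<mu> \<theta>"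
      and conj: "\<And>a z. L_point_in G a z \<mu> \<Longrightarrow> L_contained G (L_conjugate G \<eta> a z) \<theta>" for \<theta>
  proof (rule L_contained_antisym)
    show "L_subset G \<theta>" "L_contained G \<theta> \<mu>" "L_subset G \<mu>"
      using \<theta> assms(2) by (simp_all add: L_subgroup_of_def L_subgroup_def)
    have "L_contained G \<eta> \<theta>"
      using conj[of "\<mu> \<one>\<^bsub>G\<^esub>" "\<one>\<^bsub>G\<^esub>"] by (simp add: L_point_in_def L_conjugate_one[OF \<eta>])
    then have gen: "L_contained G (L_generated G \<mu> \<eta> (L_conjugate G \<eta> (\<mu> x) x)) \<theta>"
      if "x \<in> carrier G" for x
      using L_generated_least[OF \<theta>] conj that by (simp add: L_point_in_def)
    \<comment> \<open>The height \<open>\<mu> x\<close> is the largest for which the point at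
      \<open>x\<close> lies in \<open>\<mu>\<close>, so abnormality yields the full value
      there.\<close>
    have "\<mu> x \<le> L_generated G \<mu> \<eta> (L_conjugate G \<eta> (\<mu> x) x) x" if "x \<in> carrier G" for x
      using assms(3) that by (simp add: abnormal_L_subgroup_def L_point_in_def)
    then show "L_contained G \<mu> \<theta>"
      using gen unfolding L_contained_def by (meson order_trans)
  qed
  with \<eta> show ?thesis by (auto simp: contranormal_L_subgroup_def)
qed

end
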